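(* Let $\{a_n\}$ be an increasing sequence of real numbers such that the set $A = \{\lfloor a_n \rfloor\} \subset \mathbb{Z}$ has positive upper Banach density. Then, for each $\epsilon \in (0,1]$, there exists a $(1-\epsilon)$-large set $S \subset \mathbb{R}$ that does not contain any affine copy of $\{a_n\}$.
   Context: $\lfloor x \rfloor$ denotes the largest integer not exceeding $x$. A set $A \subset \mathbb{Z}$ has positive upper Banach density if $\limsup_{n \to \infty} \max_h \frac{\#(A \cap \{h+1, h+2, \ldots, h+n\})}{n} > 0$, where $h$ ranges over the integers and $\#$ denotes cardinality. $|A|$ denotes the Lebesgue measure of a measurable set $A \subseteq \mathbb{R}$. For $\epsilon \in (0,1]$, a $(1-\epsilon)$-large set is a Lebesgue measurable set $S \subseteq \mathbb{R}$ such that $|S \cap I| \geq 1-\epsilon$ for every interval $I \subset \mathbb{R}$ of unit length. An affine copy of $\{a_n\}$ is a set of the form $x\{a_n\} + t = \{x a_n + t\}$ (over all indices $n$) with $x \in \mathbb{R} \setminus \{0\}$ and $t \in \mathbb{R}$. *)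

theory Defs
  imports "HOL-Analysis.Analysis"
begin

text \<open>For fixed \<open>n\<close> the window counts lie in \<open>{0..n}\<close>, so the maximum over all integers \<open>h\<close> is
  attained (lemma \<open>finite_window_densities\<close>). The term for \<open>n = 0\<close> is \<open>0\<close>, which does not affect
  the limsup.\<close>

definition upper_banach_density :: "int set \<Rightarrow> ereal" where
  "upper_banach_density A =
     limsup (\<lambda>n::nat. ereal (Max (range (\<lambda>h::int. real (card (A \<inter> {h+1..h + int n})) / real n))))"

lemma finite_window_densities:
  "finite (range (\<lambda>h::int. real (card (A \<inter> {h+1..h + int n})) / real n))"
proof (rule finite_subset)
  have "card (A \<inter> {h+1..h + int n}) \<le> n" for h :: int
    using card_mono[of "{h+1..h + int n}" "A \<inter> {h+1..h + int n}"] by simp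
  then show "range (\<lambda>h::int. real (card (A \<inter> {h+1..h + int n})) / real n)
      \<subseteq> (\<lambda>k. real k / real n) ` {..n}"
    by auto
qed simp

text \<open>Unit-length intervals may be open, closed or half-open. Unbounded intervals are excluded
  because \<^const>\<open>measure\<close> assigns them the value \<open>0\<close>.\<close>

definition large_set :: "real \<Rightarrow> real set \<Rightarrow> bool" where
  "large_set p S \<longleftrightarrow> S \<in> sets lebesgue \<and>
     (\<forall>I. is_interval I \<and> measure lebesgue I = 1 \<longrightarrow> measure lebesgue (S \<inter> I) \<ge> p)"

definition affine_copy_of :: "real set \<Rightarrow> real set \<Rightarrow> bool" where
  "affine_copy_of B E \<longleftrightarrow> (\<exists>x t. x \<noteq> 0 \<and> B = (\<lambda>u. x * u + t) ` E)"

end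

theory Submission imports Defs "HOL-Real_Asymp.Real_Asymp"
begin
text \<open>
  The set \<open>S\<close> is the real line with one short hole removed from near each unit interval
  \<open>[k, k + 1)\<close>: the hole starts at \<open>k + f k / m\<close> and has length \<open>3 / m\<close>, where \<open>f k\<close> is one of
  the \<open>m\<close> colours \<open>0, \<dots>, m - 1\<close>. A unit interval meets at most four holes, so \<open>S\<close> is
  \<open>(1 - 12 / m)\<close>-large whatever the colouring \<open>f\<close> is
  (\<open>complement_of_short_intervals_large\<close>). The whole problem is to choose \<open>f\<close> so that every
  affine copy \<open>x a\<^sub>n + t\<close> falls into some hole.

  \<^emph>\<open>Bounded scales.\<close> Suppose first that \<open>1/q \<le> |x| \<le> q\<close>. Positive upper Banach density yields
  arbitrarily long windows of length \<open>L\<close> containing at least \<open>c L\<close> values of \<open>\<lfloor>a\<^sub>n\<rfloor>\<close>; a fixed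
  proportion of these points is \<open>q\<close>-separated, so that under \<open>x\<close> and \<open>t\<close> they fall into distinct unit
  intervals. A random colouring misses all \<open>N\<close> of them with probability \<open>(1 - 1/m)^N\<close>, which is
  exponentially small in \<open>L\<close>. Rounding \<open>x\<close> and \<open>t\<close> to a grid that is fine enough to move points
  by less than \<open>2 / m\<close> leaves only polynomially many pairs to consider, provided that \<open>t\<close> ranges
  over a bounded set. The window may lie extremely far from the origin compared with \<open>L\<close>, and moving it
  back changes \<open>t\<close> by a huge amount; the remedy is to use a periodic colouring with a period slightly
  longer than the dilated window, so that only \<open>t\<close> modulo the period matters. A union bound then
  gives a good colouring (\<open>exists_colouring_hitting_all_patterns\<close>,
  \<open>exists_periodic_colouring\<close>).

  \<^emph>\<open>All scales.\<close> Discarding the points \<open>a\<^sub>n\<close> below a bound costs only finitely many values of the floor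
  and does not affect the density, because an increasing sequence is bounded below. Hence, for
  \<open>1/q \<le> |x| \<le> q\<close> and \<open>|t| \<le> q\<close>, the hits can be confined to the indices \<open>k\<close> with
  \<open>M \<le> |k| < M'\<close>, where \<open>M\<close> is prescribed in advance
  (\<open>exists_colouring_beyond\<close>). So the conditions for \<open>q = 1, 2, \<dots>\<close> can be met on
  successive disjoint blocks of indices, and each pair \<open>(x, t)\<close> with \<open>x \<noteq> 0\<close> is covered by some
  \<open>q\<close>.
\<close>

section \<open>Counting colourings\<close>

text \<open>
  The union bound for uniformly random colourings of \<open>X\<close>, in counting form. A pattern \<open>\<tau>\<close>
  prescribes the colour \<open>\<gamma> \<tau> b\<close> at the position \<open>\<kappa> \<tau> b\<close>; since the positions are distinct, a
  proportion \<open>(1 - 1 / card Y) ^ card B\<close> of all colourings violates all of its prescriptions.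
\<close>

lemma exists_colouring_hitting_all_patterns:
  fixes \<kappa> :: "'t \<Rightarrow> 'b \<Rightarrow> 'k" and \<gamma> :: "'t \<Rightarrow> 'b \<Rightarrow> 'c"
  assumes fin: "finite T" "finite B" "finite X" "finite Y"
    and inj: "\<And>\<tau>. \<tau> \<in> T \<Longrightarrow> inj_on (\<kappa> \<tau>) B"
    and pos: "\<And>\<tau> b. \<tau> \<in> T \<Longrightarrow> b \<in> B \<Longrightarrow> \<kappa> \<tau> b \<in> X"
    and col: "\<And>\<tau> b. \<tau> \<in> T \<Longrightarrow> b \<in> B \<Longrightarrow> \<gamma> \<tau> b \<in> Y"
    and less: "real (card T) * (1 - 1 / real (card Y)) ^ card B < 1"
    and ne: "Y \<noteq> {}"
  obtains p where "\<And>k. k \<in> X \<Longrightarrow> p k \<in> Y"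
    and "\<And>\<tau>. \<tau> \<in> T \<Longrightarrow> \<exists>b\<in>B. p (\<kappa> \<tau> b) = \<gamma> \<tau> b"
proof -
  define y where "y = card Y"
  have y0: "y > 0" using ne fin by (simp add: y_def card_gt_0_iff)
  define Bad where "Bad \<tau> = PiE X (\<lambda>k. if k \<in> \<kappa> \<tau> ` B
      then Y - {\<gamma> \<tau> (inv_into B (\<kappa> \<tau>) k)} else Y)" for \<tau>
  have card_Bad: "real (card (Bad \<tau>)) = real y ^ card X * (1 - 1 / real y) ^ card B"
    if "\<tau> \<in> T" for \<tau>
  proof -
    have sub: "\<kappa> \<tau> ` B \<subseteq> X" using pos that by auto
    have "card (Bad \<tau>) = (\<Prod>k\<in>X. card (if k \<in> \<kappa> \<tau> ` B
        then Y - {\<gamma> \<tau> (inv_into B (\<kappa> \<tau>) k)} else Y))"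
      unfolding Bad_def using fin by (rule_tac card_PiE) simp
    also have "real \<dots> = (\<Prod>k\<in>X. real y * (if k \<in> \<kappa> \<tau> ` B then 1 - 1 / real y else 1))"
      unfolding of_nat_prod
    proof (rule prod.cong[OF refl])
      fix k assume "k \<in> X"
      have "\<gamma> \<tau> (inv_into B (\<kappa> \<tau>) k) \<in> Y" if "k \<in> \<kappa> \<tau> ` B"
        using col[OF \<open>\<tau> \<in> T\<close>] inv_into_into[OF that] by blast
      then show "real (card (if k \<in> \<kappa> \<tau> ` B then Y - {\<gamma> \<tau> (inv_into B (\<kappa> \<tau>) k)} else Y))
          = real y * (if k \<in> \<kappa> \<tau> ` B then 1 - 1 / real y else 1)"
        using y0 fin by (auto simp: y_def field_simps card_Diff_singleton of_nat_diff)
    qed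
    also have "\<dots> = real y ^ card X * (\<Prod>k\<in>X. if k \<in> \<kappa> \<tau> ` B then 1 - 1 / real y else 1)"
      by (simp add: prod.distrib)
    also have "(\<Prod>k\<in>X. if k \<in> \<kappa> \<tau> ` B then 1 - 1 / real y else 1)
        = (\<Prod>k\<in>\<kappa> \<tau> ` B. 1 - 1 / real y)"
      using sub fin by (simp add: prod.If_cases Int_absorb1)
    also have "\<dots> = (1 - 1 / real y) ^ card B"
      using inj[OF that] by (simp add: card_image)
    finally show ?thesis .
  qed
  have "real (card (\<Union>\<tau>\<in>T. Bad \<tau>)) \<le> (\<Sum>\<tau>\<in>T. real (card (Bad \<tau>)))"
    using card_UN_le[OF fin(1), of Bad] by (metis of_nat_mono of_nat_sum)
  also have "\<dots> = real y ^ card X * (real (card T) * (1 - 1 / real y) ^ card B)"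
    using card_Bad by simp
  also have "\<dots> < real y ^ card X" using less y0 by (simp add: y_def)
  also have "\<dots> = real (card (PiE X (\<lambda>_. Y)))" using fin by (simp add: card_PiE y_def)
  finally have lt: "card (\<Union>\<tau>\<in>T. Bad \<tau>) < card (PiE X (\<lambda>_. Y))" by simp
  have "\<not> PiE X (\<lambda>_. Y) \<subseteq> (\<Union>\<tau>\<in>T. Bad \<tau>)"
  proof
    assume "PiE X (\<lambda>_. Y) \<subseteq> (\<Union>\<tau>\<in>T. Bad \<tau>)"
    moreover have "finite (\<Union>\<tau>\<in>T. Bad \<tau>)" using fin by (auto simp: Bad_def intro!: finite_PiE)
    ultimately show False using lt card_mono by (metis not_less)
  qed
  then obtain p where p: "p \<in> PiE X (\<lambda>_. Y)" "\<And>\<tau>. \<tau> \<in> T \<Longrightarrow> p \<notin> Bad \<tau>" by blast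
  show thesis
  proof
    show "p k \<in> Y" if "k \<in> X" for k using p that by auto
    fix \<tau> assume \<tau>: "\<tau> \<in> T"
    show "\<exists>b\<in>B. p (\<kappa> \<tau> b) = \<gamma> \<tau> b"
    proof (rule ccontr)
      assume "\<not> ?thesis"
      then have "p \<in> Bad \<tau>" unfolding Bad_def using p(1) inj[OF \<tau>]
        by (auto simp: PiE_iff inv_into_f_f)
      with p(2) \<tau> show False by blast
    qed
  qed
qed

text \<open>
  The first factors will count pairs \<open>(x, t)\<close> up to rounding, and the exponential will bound the
  probability that a random colouring fails for one pair.
\<close>

lemma quadratic_times_exp_tendsto_0:
  fixes d e A B C :: real
  assumes "d > 0"
  shows "((\<lambda>n::nat. (A * real n + 1) * (B * real n + 2) * C * exp (e - d * real n)) \<longlongrightarrow> 0) at_top"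
  using assms by real_asymp

section \<open>Dense windows\<close>

lemma frequently_dense_window:
  assumes "upper_banach_density A > 0"
  obtains c :: real where "c > 0"
    and "\<exists>\<^sub>F n in sequentially. \<exists>h::int. c * real n < real (card (A \<inter> {h+1..h + int n}))"
proof -
  define X where "X n = Max (range (\<lambda>h::int. real (card (A \<inter> {h+1..h + int n})) / real n))" for n :: nat
  obtain c where c: "0 < ereal c" "ereal c < limsup (\<lambda>n. ereal (X n))"
    using ereal_dense2[OF assms] unfolding upper_banach_density_def X_def by blast
  have "\<exists>\<^sub>F n in sequentially. ereal c < ereal (X n)"
  proof (rule ccontr)
    assume "\<not> ?thesis"
    then have "\<forall>\<^sub>F n in sequentially. ereal (X n) \<le> ereal c"
      by (simp add: frequently_def not_less)
    then have "limsup (\<lambda>n. ereal (X n)) \<le> ereal c" by (rule Limsup_bounded)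
    with c show False by simp
  qed
  then have "\<exists>\<^sub>F n in sequentially. \<exists>h::int. c * real n < real (card (A \<inter> {h+1..h + int n}))"
  proof (rule frequently_elim1)
    fix n assume n: "ereal c < ereal (X n)"
    have "X n \<in> range (\<lambda>h::int. real (card (A \<inter> {h+1..h + int n})) / real n)"
      unfolding X_def by (rule Max_in[OF finite_window_densities]) simp
    then obtain h where h: "X n = real (card (A \<inter> {h+1..h + int n})) / real n" by blast
    have "n > 0" using n c h by (cases n) auto
    then have "c * real n < real (card (A \<inter> {h+1..h + int n}))"
      using n h by (simp add: field_simps)
    then show "\<exists>h::int. c * real n < real (card (A \<inter> {h+1..h + int n}))" ..
  qed
  then show thesis using that c by simp
qed

section \<open>Removing one short hole near each unit interval\<close>

definition hole :: "nat \<Rightarrow> int \<Rightarrow> int \<Rightarrow> real set" where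
  "hole m k c = {of_int k + of_int c / real m .. of_int k + of_int c / real m + 3 / real m}"

lemma unit_interval_subset:
  fixes I :: "real set"
  assumes "is_interval I" "measure lebesgue I = 1"
  obtains s where "I \<subseteq> {s..s+1}"
proof -
  have "I \<in> sets lebesgue" using assms(2) measure_notin_sets by fastforce
  moreover have "emeasure lebesgue I \<noteq> \<infinity>" using assms(2) by (auto simp: measure_def)
  ultimately have lm: "I \<in> lmeasurable"
    by (simp add: fmeasurable_def less_top[symmetric])
  have d: "v - u \<le> 1" if "u \<in> I" "v \<in> I" for u v
  proof (cases "u \<le> v")
    case True
    have "{u..v} \<subseteq> I"
      using mem_is_interval_1_I[OF assms(1) that] by (auto simp: subset_eq)
    then have "measure lebesgue {u..v} \<le> measure lebesgue I"
      using lm by (intro measure_mono_fmeasurable) auto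
    then show ?thesis using True assms by simp
  qed simp
  have ne: "I \<noteq> {}" using assms(2) by auto
  then obtain w where w: "w \<in> I" by blast
  have bb: "bdd_below I" by (rule bdd_belowI[of _ "w - 1"]) (use d w in force)
  have "v \<le> Inf I + 1" if "v \<in> I" for v
    using cInf_greatest[OF ne, of "v - 1"] d that by force
  then show thesis using that[of "Inf I"] cInf_lower[OF _ bb] by (auto simp: subset_eq)
qed

text \<open>
  A hole that meets \<open>[s, s + 1]\<close> has its index \<open>k\<close> in \<open>[s - 2, s + 1]\<close>, because \<open>m \<ge> 3\<close> makes
  holes no longer than \<open>1\<close>. This leaves at most four holes of length \<open>3 / m\<close>.
\<close>

lemma complement_of_short_intervals_large:
  fixes f :: "int \<Rightarrow> int" and m :: nat
  assumes m: "3 \<le> m" and f: "\<And>k. 0 \<le> f k \<and> f k < int m"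
  defines "E \<equiv> (\<Union>k. hole m k (f k))"
  shows "large_set (1 - 12 / real m) (- E)"
proof -
  define c where "c k = of_int k + of_int (f k) / real m" for k
  have E: "E = (\<Union>k. {c k .. c k + 3 / real m})" by (simp add: E_def hole_def c_def)
  have ck: "of_int k \<le> c k" "c k < of_int k + 1" for k
    using f[of k] m by (auto simp: c_def field_simps)
  have Eb: "E \<in> sets lebesgue" unfolding E by auto
  have "1 - 12 / real m \<le> measure lebesgue (- E \<inter> I)"
    if I: "is_interval I" "measure lebesgue I = 1" for I
  proof -
    obtain s where s: "I \<subseteq> {s..s+1}" using unit_interval_subset[OF I] .
    have lI: "I \<in> sets lebesgue" using I(2) measure_notin_sets by fastforce
    have fI: "I \<in> lmeasurable"
      using fmeasurableI2[OF lmeasurable_cbox s[folded box_real] ] lI by simp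
    define K where "K = {\<lceil>s - 2\<rceil>..\<lfloor>s + 1\<rfloor>}"
    have cK: "card K \<le> 4" unfolding K_def by (simp, linarith)
    have sub: "E \<inter> I \<subseteq> (\<Union>k\<in>K. {c k .. c k + 3 / real m})"
    proof
      fix v assume "v \<in> E \<inter> I"
      then obtain k where k: "c k \<le> v" "v \<le> c k + 3 / real m" "s \<le> v" "v \<le> s + 1"
        using s unfolding E by auto
      have "3 / real m \<le> 1" using m by simp
      then have "s - 2 \<le> of_int k" "of_int k \<le> s + 1" using ck[of k] k by linarith+
      then have "k \<in> K" unfolding K_def atLeastAtMost_iff ceiling_le_iff le_floor_iff by blast
      with k show "v \<in> (\<Union>k\<in>K. {c k .. c k + 3 / real m})" by auto
    qed
    have "measure lebesgue (E \<inter> I) \<le> measure lebesgue (\<Union>k\<in>K. {c k .. c k + 3 / real m})"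
      using Eb lI by (intro measure_mono_fmeasurable[OF sub]) (auto simp: K_def intro!: fmeasurable.finite_UN)
    also have "\<dots> \<le> (\<Sum>k\<in>K. measure lebesgue {c k .. c k + 3 / real m})"
      by (rule measure_UNION_le) (auto simp: K_def)
    also have "\<dots> = real (card K) * (3 / real m)" by simp
    also have "\<dots> \<le> 4 * (3 / real m)" using cK by (intro mult_right_mono) auto
    finally have "measure lebesgue (E \<inter> I) \<le> 12 / real m" by simp
    moreover have "measure lebesgue (I - E \<inter> I) = measure lebesgue I - measure lebesgue (E \<inter> I)"
      using fI Eb lI by (intro measurable_measure_Diff) auto
    moreover have "- E \<inter> I = I - E \<inter> I" by blast
    ultimately show ?thesis using I by simp
  qed
  moreover have "- E \<in> sets lebesgue" using Eb by (simp add: Compl_in_sets_lebesgue)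
  ultimately show ?thesis by (simp add: large_set_def)
qed

section \<open>A periodic colouring for scales in a bounded range\<close>

lemma grid_rounding:
  fixes v d :: real
  assumes "d > 0"
  shows "0 \<le> v - of_int \<lfloor>v * d\<rfloor> / d" and "v - of_int \<lfloor>v * d\<rfloor> / d \<le> 1 / d"
proof -
  have "v - of_int \<lfloor>v * d\<rfloor> / d = frac (v * d) / d"
    using assms by (simp add: frac_def field_simps)
  moreover have "0 \<le> frac (v * d) / d" "frac (v * d) / d \<le> 1 / d"
    using assms frac_lt_1[of "v * d"] by (auto intro: divide_right_mono)
  ultimately show "0 \<le> v - of_int \<lfloor>v * d\<rfloor> / d" "v - of_int \<lfloor>v * d\<rfloor> / d \<le> 1 / d" by auto
qed

text \<open>
  The translation \<open>t\<close> is arbitrary here: the colouring has period \<open>P = q L + 2\<close>, so only \<open>t\<close>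
  modulo \<open>P\<close> matters. The pair \<open>(x, t)\<close> is rounded down to \<open>(r / D, s / m)\<close> with \<open>D = m q L\<close>. The
  rounded pairs, at most \<open>(2 q D + 1) (P m)\<close> many, are the patterns of the union bound: each point
  \<open>y\<close> of a rounded copy asks for the hole at \<open>\<lfloor>y\<rfloor>\<close> to have the colour \<open>\<lfloor>m frac y\<rfloor>\<close>. Rounding to a colour
  and rounding \<open>x\<close> and \<open>t\<close> contribute at most \<open>1 / m\<close> each, which is why holes have length
  \<open>3 / m\<close>.
\<close>

lemma exists_periodic_colouring:
  fixes B :: "real set" and q L m :: nat
  assumes B: "finite B" "B \<subseteq> {0..real L}"
    and sep: "\<And>b b'. b \<in> B \<Longrightarrow> b' \<in> B \<Longrightarrow> b \<noteq> b' \<Longrightarrow> real q \<le> \<bar>b - b'\<bar>"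
    and ge1: "1 \<le> q" "1 \<le> L" "1 \<le> m"
    and few: "(2 * real m * real q ^ 2 * real L + 1) * (real q * real L + 2) * real m
               * (1 - 1 / real m) ^ card B < 1"
  obtains f :: "int \<Rightarrow> int" where "\<And>k. f k \<in> {0..<int m}"
    and "\<And>x t. 1 / real q \<le> \<bar>x\<bar> \<Longrightarrow> \<bar>x\<bar> \<le> real q \<Longrightarrow>
           \<exists>b\<in>B. \<exists>k. x * b + t \<in> hole m k (f k)"
proof -
  define D where "D = m * q * L"
  define P where "P = q * L + 2"
  have D0: "D > 0" using ge1 by (simp add: D_def)
  have P0: "P > 0" by (simp add: P_def)
  define T where "T = {r::int. int (m * L) \<le> \<bar>r\<bar> \<and> \<bar>r\<bar> \<le> int (q * D)} \<times> {0..<int (P * m)}"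
  define y where "y = (\<lambda>(r::int, s::int) b. of_int r / real D * b + of_int s / real m)"
  define \<kappa> where "\<kappa> \<tau> b = \<lfloor>y \<tau> b\<rfloor> mod int P" for \<tau> b
  define \<gamma> where "\<gamma> \<tau> b = \<lfloor>real m * frac (y \<tau> b)\<rfloor>" for \<tau> b
  have Tsub: "T \<subseteq> {- int (q * D)..int (q * D)} \<times> {0..<int (P * m)}"
    by (auto simp: T_def)
  have finT: "finite T" by (rule finite_subset[OF Tsub]) simp
  have "card T \<le> card ({- int (q * D)..int (q * D)} \<times> {0..<int (P * m)})"
    by (rule card_mono[OF _ Tsub]) simp
  also have "\<dots> = (2 * (q * D) + 1) * (P * m)"
    by (simp add: card_cartesian_product nat_add_distrib nat_mult_distrib)
  finally have "real (card T) \<le> real ((2 * (q * D) + 1) * (P * m))" by (rule of_nat_mono)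
  also have "\<dots> = (2 * real m * real q ^ 2 * real L + 1) * (real q * real L + 2) * real m"
    by (simp add: D_def P_def power2_eq_square algebra_simps)
  finally have "real (card T) * (1 - 1 / real m) ^ card B
      \<le> (2 * real m * real q ^ 2 * real L + 1) * (real q * real L + 2) * real m
               * (1 - 1 / real m) ^ card B"
    using ge1 by (intro mult_right_mono) auto
  then have less: "real (card T) * (1 - 1 / real (card {0..<int m})) ^ card B < 1"
    using few by simp
  \<comment> \<open>Points of a copy are at least \<open>1\<close> apart and span at most \<open>q L < P - 1\<close>, so their floors stay
    distinct modulo \<open>P\<close>. The lower bound survives rounding because \<open>D / q\<close> is an integer, so that
    rounding preserves \<open>1 / q \<le> |x|\<close>.\<close>
  have inj: "inj_on (\<kappa> \<tau>) B" if "\<tau> \<in> T" for \<tau>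
  proof (rule inj_onI, rule ccontr)
    fix b b' assume b: "b \<in> B" "b' \<in> B" and eq: "\<kappa> \<tau> b = \<kappa> \<tau> b'" and ne: "b \<noteq> b'"
    obtain r s where \<tau>: "\<tau> = (r, s)" by (cases \<tau>)
    define x where "x = of_int r / real D"
    have r: "real (m * L) \<le> \<bar>of_int r\<bar>" "\<bar>of_int r\<bar> \<le> real (q * D)"
    proof -
      have "int (m * L) \<le> \<bar>r\<bar>" "\<bar>r\<bar> \<le> int (q * D)" using that by (auto simp: T_def \<tau>)
      then have "real_of_int (int (m * L)) \<le> real_of_int \<bar>r\<bar>"
        "real_of_int \<bar>r\<bar> \<le> real_of_int (int (q * D))" by (simp_all only: of_int_le_iff)
      then show "real (m * L) \<le> \<bar>of_int r\<bar>" "\<bar>of_int r\<bar> \<le> real (q * D)"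
        by (simp_all only: of_int_abs of_int_of_nat_eq)
    qed
    have x: "1 \<le> \<bar>x\<bar> * real q" "\<bar>x\<bar> \<le> real q"
    proof -
      have abs_x: "\<bar>x\<bar> = \<bar>of_int r\<bar> / real D" by (simp add: x_def)
      have "real D \<le> \<bar>of_int r\<bar> * real q"
        using mult_right_mono[OF r(1), of "real q"] by (simp add: D_def mult_ac)
      then show "1 \<le> \<bar>x\<bar> * real q" using D0 by (simp add: abs_x pos_le_divide_eq)
      show "\<bar>x\<bar> \<le> real q" using r(2) D0 by (simp add: abs_x pos_divide_le_eq)
    qed
    have diff: "y \<tau> b - y \<tau> b' = x * (b - b')"
      by (simp add: y_def \<tau> x_def algebra_simps diff_divide_distrib)
    have "1 \<le> \<bar>x\<bar> * real q" by (rule x)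
    also have "\<dots> \<le> \<bar>x\<bar> * \<bar>b - b'\<bar>" using sep[OF b ne] by (intro mult_left_mono) auto
    also have "\<dots> = \<bar>y \<tau> b - y \<tau> b'\<bar>" by (simp add: diff abs_mult)
    finally have lo: "\<lfloor>y \<tau> b\<rfloor> \<noteq> \<lfloor>y \<tau> b'\<rfloor>" by linarith
    have "\<bar>y \<tau> b - y \<tau> b'\<bar> = \<bar>x\<bar> * \<bar>b - b'\<bar>" by (simp add: diff abs_mult)
    also have "\<dots> \<le> real q * real L"
    proof (rule mult_mono)
      have "b \<in> {0..real L}" "b' \<in> {0..real L}" using b B by blast+
      then show "\<bar>b - b'\<bar> \<le> real L" by auto
    qed (use x in auto)
    finally have "\<bar>y \<tau> b - y \<tau> b'\<bar> \<le> real_of_int (int (q * L))" by simp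
    then have "\<bar>\<lfloor>y \<tau> b\<rfloor> - \<lfloor>y \<tau> b'\<rfloor>\<bar> < int P" unfolding P_def by linarith
    moreover have "int P dvd \<lfloor>y \<tau> b\<rfloor> - \<lfloor>y \<tau> b'\<rfloor>"
      using eq by (simp add: \<kappa>_def mod_eq_dvd_iff)
    ultimately show False using lo zdvd_not_zless[of "\<bar>\<lfloor>y \<tau> b\<rfloor> - \<lfloor>y \<tau> b'\<rfloor>\<bar>" "int P"] by simp
  qed
  have col: "\<gamma> \<tau> b \<in> {0..<int m}" for \<tau> b
  proof -
    have "real m * frac (y \<tau> b) < real m" using ge1 frac_lt_1[of "y \<tau> b"] by simp
    then show ?thesis by (simp add: \<gamma>_def floor_less_iff)
  qed
  obtain p where p: "\<And>k. k \<in> {0..<int P} \<Longrightarrow> p k \<in> {0..<int m}"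
    and hit: "\<And>\<tau>. \<tau> \<in> T \<Longrightarrow> \<exists>b\<in>B. p (\<kappa> \<tau> b) = \<gamma> \<tau> b"
  proof (rule exists_colouring_hitting_all_patterns
      [of T B "{0..<int P}" "{0..<int m}" \<kappa> \<gamma>, OF finT B(1) _ _ inj _ col less])
    show "\<kappa> \<tau> b \<in> {0..<int P}" for \<tau> b using P0 by (simp add: \<kappa>_def)
    show "{0..<int m} \<noteq> {}" using ge1 by simp
  qed (use that in auto)
  define f where "f k = p (k mod int P)" for k
  show thesis
  proof
    show "f k \<in> {0..<int m}" for k unfolding f_def using P0 by (intro p) simp
    fix x t :: real assume x: "1 / real q \<le> \<bar>x\<bar>" "\<bar>x\<bar> \<le> real q"
    define z where "z = \<lfloor>t / real P\<rfloor>"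
    define t' where "t' = t - real P * of_int z"
    have t': "0 \<le> t'" "t' < real P"
      using P0 floor_divide_lower[of "real P" t] floor_divide_upper[of "real P" t]
      by (simp_all add: t'_def z_def algebra_simps)
    define r where "r = \<lfloor>x * real D\<rfloor>"
    define s where "s = \<lfloor>t' * real m\<rfloor>"
    have "1 / real q * real D \<le> \<bar>x\<bar> * real D" "\<bar>x\<bar> * real D \<le> real q * real D"
      by (intro mult_right_mono x; simp)+
    then have "real_of_int (int (m * L)) \<le> \<bar>x * real D\<bar>"
      "\<bar>x * real D\<bar> \<le> real_of_int (int (q * D))"
      using ge1 by (simp_all add: D_def abs_mult)
    then have "\<bar>r\<bar> \<ge> int (m * L)" "\<bar>r\<bar> \<le> int (q * D)"
      unfolding r_def by linarith+
    moreover have "t' * real m < real (P * m)" using t' ge1 by simp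
    then have "s \<in> {0..<int (P * m)}" using t'(1) by (simp add: s_def floor_less_iff)
    ultimately have "(r, s) \<in> T" by (simp add: T_def)
    then obtain b where b: "b \<in> B" "p (\<kappa> (r, s) b) = \<gamma> (r, s) b" using hit by blast
    define w where "w = y (r, s) b"
    define k where "k = \<lfloor>w\<rfloor> + int P * z"
    have fk: "f k = \<lfloor>real m * frac w\<rfloor>"
      using b(2) by (simp add: f_def k_def \<kappa>_def \<gamma>_def w_def)
    have "of_int (f k) \<le> real m * frac w" "real m * frac w < of_int (f k) + 1"
      unfolding fk by linarith+
    then have w: "of_int (f k) / real m \<le> frac w" "frac w \<le> of_int (f k) / real m + 1 / real m"
      using ge1 by (simp_all add: field_simps)
    have eq: "x * b + t = of_int k + frac w + (x - of_int r / real D) * b + (t' - of_int s / real m)"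
      by (simp add: k_def w_def y_def frac_def t'_def algebra_simps)
    have dx: "0 \<le> x - of_int r / real D" "x - of_int r / real D \<le> 1 / real D"
      unfolding r_def using D0 by (intro grid_rounding; simp)+
    have b_bounds: "0 \<le> b" "b \<le> real L" using b B by auto
    have "0 \<le> (x - of_int r / real D) * b" using dx b_bounds by (intro mult_nonneg_nonneg)
    moreover have "(x - of_int r / real D) * b \<le> 1 / real D * real L"
      using dx b_bounds by (intro mult_mono) auto
    moreover have "1 / real D * real L \<le> 1 / real m"
      using ge1 by (simp add: D_def field_simps)
    moreover have "0 \<le> t' - of_int s / real m" "t' - of_int s / real m \<le> 1 / real m"
      unfolding s_def using ge1 by (intro grid_rounding; simp)+
    ultimately have "of_int k + of_int (f k) / real m \<le> x * b + t"
      "x * b + t \<le> of_int k + of_int (f k) / real m + 3 * (1 / real m)"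
      using w unfolding eq by linarith+
    then have "x * b + t \<in> hole m k (f k)" by (simp add: hole_def)
    with b show "\<exists>b\<in>B. \<exists>k. x * b + t \<in> hole m k (f k)" by blast
  qed
qed

section \<open>Assembling the scales\<close>

text \<open>
  The periodic colouring is applied to a long dense window, translated to start at \<open>0\<close>, from which
  all values with floor at most \<open>C\<close> are removed. For \<open>|x| \<ge> 1 / q\<close> and \<open>|t| \<le> q\<close> the remaining points are
  sent so far out that they can only fall into holes of index at least \<open>M\<close> in absolute value, and
  they are finitely many, which bounds the indices from above.
\<close>

lemma exists_colouring_beyond:
  fixes a :: "nat \<Rightarrow> real" and q m M :: nat
  assumes dense: "upper_banach_density (range (\<lambda>n. \<lfloor>a n\<rfloor>)) > 0"
    and low: "\<And>n. l \<le> a n" and q: "1 \<le> q" and m: "3 \<le> m"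
  shows "\<exists>(f :: int \<Rightarrow> int) M'. M < M' \<and> (\<forall>k. f k \<in> {0..<int m}) \<and>
    (\<forall>x t. 1 / real q \<le> \<bar>x\<bar> \<and> \<bar>x\<bar> \<le> real q \<and> \<bar>t\<bar> \<le> real q \<longrightarrow>
      (\<exists>n k. int M \<le> \<bar>k\<bar> \<and> \<bar>k\<bar> < int M' \<and> x * a n + t \<in> hole m k (f k)))"
proof -
  define A where "A = range (\<lambda>n. \<lfloor>a n\<rfloor>)"
  obtain \<nu> where \<nu>: "\<And>u. u \<in> A \<Longrightarrow> \<lfloor>a (\<nu> u)\<rfloor> = u"
  proof
    show "\<lfloor>a (SOME n. \<lfloor>a n\<rfloor> = u)\<rfloor> = u" if "u \<in> A" for u
      using that unfolding A_def by (intro someI_ex[of "\<lambda>n. \<lfloor>a n\<rfloor> = u"]) auto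
  qed
  define C where "C = int (q * (M + q + 4))"
  define C0 where "C0 = card {\<lfloor>l\<rfloor>..C}"
  obtain c where c: "c > 0" and
    fr: "\<exists>\<^sub>F L in sequentially. \<exists>h::int. c * real L < real (card (A \<inter> {h+1..h + int L}))"
    using frequently_dense_window[OF dense] unfolding A_def by blast
  \<comment> \<open>Missing \<open>N \<ge> (c L - C0) / (q + 1)\<close> points has probability at most
    \<open>exp (\<beta> C0 - \<beta> c L)\<close>.\<close>
  define \<beta> where "\<beta> = - ln (1 - 1 / real m) / real (q + 1)"
  have \<rho>: "0 < 1 - 1 / real m" "1 - 1 / real m < 1" using m by auto
  have \<beta>: "\<beta> > 0" unfolding \<beta>_def using \<rho> by (intro divide_pos_pos) auto
  have "((\<lambda>L::nat. (2 * real m * real q ^ 2 * real L + 1) * (real q * real L + 2) * real m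
          * exp (\<beta> * real C0 - (\<beta> * c) * real L)) \<longlongrightarrow> 0) at_top"
    by (rule quadratic_times_exp_tendsto_0) (use \<beta> c in simp)
  then have "\<forall>\<^sub>F L in sequentially. (2 * real m * real q ^ 2 * real L + 1) * (real q * real L + 2)
      * real m * exp (\<beta> * real C0 - (\<beta> * c) * real L) < 1"
    by (rule order_tendstoD) simp
  then have "\<forall>\<^sub>F L in sequentially. 1 \<le> L \<and> (2 * real m * real q ^ 2 * real L + 1)
      * (real q * real L + 2) * real m * exp (\<beta> * real C0 - (\<beta> * c) * real L) < 1"
    using eventually_ge_at_top[of 1] by eventually_elim auto
  from frequently_ex[OF frequently_eventually_frequently[OF fr this]]
  obtain L h where L: "1 \<le> L" and h: "c * real L < real (card (A \<inter> {h+1..h + int L}))"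
    and small: "(2 * real m * real q ^ 2 * real L + 1) * (real q * real L + 2)
      * real m * exp (\<beta> * real C0 - (\<beta> * c) * real L) < 1" by blast
  define W where "W = A \<inter> {h+1..h + int L} - {\<lfloor>l\<rfloor>..C}"
  have finW: "finite W" by (simp add: W_def)
  have "card (A \<inter> {h+1..h + int L}) - C0 \<le> card W"
    unfolding W_def C0_def by (rule diff_card_le_card_Diff) simp
  then have cW: "c * real L - real C0 \<le> real (card W)" using h by linarith
  \<comment> \<open>Distinct floors in one residue class modulo \<open>q + 1\<close> differ by at least \<open>q + 1\<close>, so the
    corresponding \<open>a n\<close> differ by at least \<open>q\<close>; some class contains its share of the window.\<close>
  obtain r where r: "card ((\<lambda>u. u mod int (q + 1)) -` {r} \<inter> W) * card {0..<int (q + 1)} \<ge> card W"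
    using pigeonhole_card[of "\<lambda>u. u mod int (q + 1)" W "{0..<int (q + 1)}"] finW by auto
  define U where "U = (\<lambda>u. u mod int (q + 1)) -` {r} \<inter> W"
  have UA: "U \<subseteq> A" "finite U" using finW by (auto simp: U_def W_def)
  have Ularge: "C < u" if "u \<in> U" for u
  proof -
    have "u \<in> A" using that UA by blast
    then obtain n where "u = \<lfloor>a n\<rfloor>" by (auto simp: A_def)
    then have "\<lfloor>l\<rfloor> \<le> u" using low by (simp add: floor_mono)
    then show ?thesis using that by (auto simp: U_def W_def)
  qed
  have "card {0..<int (q + 1)} = q + 1" by simp
  then have "card W \<le> card U * (q + 1)" using r unfolding U_def by (simp only:)
  then have "real (card W) \<le> real (card U) * real (q + 1)"
    by (simp only: of_nat_mult[symmetric] of_nat_le_iff)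
  then have cU: "c * real L - real C0 \<le> real (card U) * real (q + 1)" using cW by linarith
  define b where "b u = a (\<nu> u) - of_int (h + 1)" for u
  have sep: "real q \<le> \<bar>b u - b u'\<bar>" if "u \<in> U" "u' \<in> U" "u \<noteq> u'" for u u'
  proof -
    have "u mod int (q + 1) = u' mod int (q + 1)" using that by (simp add: U_def)
    then have "int (q + 1) dvd u - u'" by (rule mod_eq_dvd_iff[THEN iffD1])
    then have "int (q + 1) \<le> \<bar>u - u'\<bar>"
      using that(3) zdvd_imp_le[of "int (q + 1)" "\<bar>u - u'\<bar>"] by simp
    moreover have "\<lfloor>a (\<nu> u)\<rfloor> = u" "\<lfloor>a (\<nu> u')\<rfloor> = u'" using that UA \<nu> by auto
    ultimately show ?thesis unfolding b_def by linarith
  qed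
  have injb: "inj_on b U"
  proof (rule inj_onI, rule ccontr)
    fix u u' assume "u \<in> U" "u' \<in> U" "b u = b u'" "u \<noteq> u'"
    then show False using sep[of u u'] q by simp
  qed
  have bL: "b ` U \<subseteq> {0..real L}"
  proof
    fix v assume "v \<in> b ` U"
    then obtain u where u: "u \<in> U" "v = b u" by blast
    then have "\<lfloor>a (\<nu> u)\<rfloor> = u" "h + 1 \<le> u" "u \<le> h + int L"
      using UA \<nu> by (auto simp: U_def W_def)
    then show "v \<in> {0..real L}" unfolding u b_def by (simp, linarith)
  qed
  have "real (card U) * ln (1 - 1 / real m) = - \<beta> * (real (card U) * real (q + 1))"
    by (simp add: \<beta>_def)
  also have "\<dots> \<le> - \<beta> * (c * real L - real C0)"
    using cU \<beta> by (intro mult_left_mono_neg) auto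
  also have "\<dots> = \<beta> * real C0 - (\<beta> * c) * real L" by (simp add: algebra_simps)
  finally have "exp (real (card U) * ln (1 - 1 / real m)) \<le> exp (\<beta> * real C0 - (\<beta> * c) * real L)"
    by simp
  moreover have "(1 - 1 / real m) ^ card (b ` U) = exp (real (card U) * ln (1 - 1 / real m))"
    unfolding card_image[OF injb] exp_of_nat_mult using \<rho> by (simp only: exp_ln)
  ultimately have "(1 - 1 / real m) ^ card (b ` U) \<le> exp (\<beta> * real C0 - (\<beta> * c) * real L)"
    by simp
  then have "(2 * real m * real q ^ 2 * real L + 1) * (real q * real L + 2)
      * real m * (1 - 1 / real m) ^ card (b ` U)
     \<le> (2 * real m * real q ^ 2 * real L + 1) * (real q * real L + 2)
      * real m * exp (\<beta> * real C0 - (\<beta> * c) * real L)"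
    by (intro mult_left_mono) auto
  also note small
  finally have few: "(2 * real m * real q ^ 2 * real L + 1) * (real q * real L + 2)
      * real m * (1 - 1 / real m) ^ card (b ` U) < 1" .
  have m1: "1 \<le> m" using m by simp
  have finbU: "finite (b ` U)" using UA by simp
  have sep': "real q \<le> \<bar>v - v'\<bar>" if "v \<in> b ` U" "v' \<in> b ` U" "v \<noteq> v'" for v v'
    using that sep by blast
  obtain f :: "int \<Rightarrow> int" where f: "\<And>k. f k \<in> {0..<int m}"
    and hit: "\<And>x t. 1 / real q \<le> \<bar>x\<bar> \<Longrightarrow> \<bar>x\<bar> \<le> real q \<Longrightarrow>
           \<exists>v\<in>b ` U. \<exists>k. x * v + t \<in> hole m k (f k)"
    using exists_periodic_colouring[OF finbU bL sep' q L m1 few] by blast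
  obtain R where R: "\<And>u. u \<in> U \<Longrightarrow> \<bar>a (\<nu> u)\<bar> \<le> R"
    using finite_imp_bounded[of "(a \<circ> \<nu>) ` U"] UA(2) unfolding bounded_iff by auto
  define M' where "M' = max (M + 1) (nat \<lceil>real q * R + real q + 3\<rceil>)"
  have "\<exists>n k. int M \<le> \<bar>k\<bar> \<and> \<bar>k\<bar> < int M' \<and> x * a n + t \<in> hole m k (f k)"
    if x: "1 / real q \<le> \<bar>x\<bar>" "\<bar>x\<bar> \<le> real q" and t: "\<bar>t\<bar> \<le> real q" for x t
  proof -
    obtain u k where u: "u \<in> U" and k: "x * b u + (x * of_int (h + 1) + t) \<in> hole m k (f k)"
      using hit[OF x] by blast
    define v where "v = x * a (\<nu> u) + t"
    have v: "v \<in> hole m k (f k)" using k by (simp add: b_def v_def algebra_simps)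
    have "0 \<le> real_of_int (f k) / real m" "real_of_int (f k) / real m \<le> 1" "3 / real m \<le> 1"
      using f[of k] m by auto
    then have kv: "of_int k \<le> v" "v \<le> of_int k + 2" using v by (auto simp: hole_def)
    have "int (q * (M + q + 4)) < \<lfloor>a (\<nu> u)\<rfloor>"
      using Ularge[OF u] \<nu>[of u] u UA unfolding C_def by auto
    then have "real (q * (M + q + 4)) \<le> a (\<nu> u)" by linarith
    then have "1 / real q * real (q * (M + q + 4)) \<le> \<bar>x\<bar> * \<bar>a (\<nu> u)\<bar>"
      using x by (intro mult_mono) auto
    then have "real M + real q + 4 \<le> \<bar>x * a (\<nu> u)\<bar>" using q by (simp add: abs_mult)
    then have "real M + 2 \<le> \<bar>v\<bar>" using t unfolding v_def by linarith
    then have "int M \<le> \<bar>k\<bar>" using kv by linarith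
    moreover have "\<bar>x * a (\<nu> u)\<bar> \<le> real q * R"
      unfolding abs_mult using x R[OF u] by (intro mult_mono) auto
    then have "\<bar>v\<bar> \<le> real q * R + real q" using t unfolding v_def by linarith
    then have "\<bar>of_int k\<bar> < real q * R + real q + 3" using kv by linarith
    then have "\<bar>k\<bar> < int M'" unfolding M'_def by linarith
    ultimately show ?thesis using v unfolding v_def by blast
  qed
  moreover have "M < M'" by (simp add: M'_def)
  ultimately show ?thesis using f by blast
qed

text \<open>
  Stage \<open>j\<close> treats \<open>1 / (j + 1) \<le> |x| \<le> j + 1\<close> and \<open>|t| \<le> j + 1\<close>, using only the indices \<open>k\<close> with
  \<open>M j \<le> |k| < M (j + 1)\<close>. These blocks are disjoint, so the colourings of all stages combine
  into one.
\<close>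

lemma exists_colouring_meeting_all_affine_copies:
  fixes a :: "nat \<Rightarrow> real" and m :: nat
  assumes dense: "upper_banach_density (range (\<lambda>n. \<lfloor>a n\<rfloor>)) > 0"
    and low: "\<And>n. l \<le> a n" and m: "3 \<le> m"
  obtains f :: "int \<Rightarrow> int" where "\<And>k. f k \<in> {0..<int m}"
    and "\<And>x t. x \<noteq> 0 \<Longrightarrow> \<exists>n k. x * a n + t \<in> hole m k (f k)"
proof -
  have "\<forall>j M. \<exists>(f :: int \<Rightarrow> int) M'. M < M' \<and> (\<forall>k. f k \<in> {0..<int m}) \<and>
    (\<forall>x t. 1 / real (Suc j) \<le> \<bar>x\<bar> \<and> \<bar>x\<bar> \<le> real (Suc j) \<and> \<bar>t\<bar> \<le> real (Suc j) \<longrightarrow>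
      (\<exists>n k. int M \<le> \<bar>k\<bar> \<and> \<bar>k\<bar> < int M' \<and> x * a n + t \<in> hole m k (f k)))"
    by (intro allI exists_colouring_beyond[OF dense low _ m]) simp
  then obtain F :: "nat \<Rightarrow> nat \<Rightarrow> int \<Rightarrow> int" and N where
    N: "\<And>j M. M < N j M" and F: "\<And>j M k. F j M k \<in> {0..<int m}" and
    hit: "\<And>j M x t. 1 / real (Suc j) \<le> \<bar>x\<bar> \<Longrightarrow> \<bar>x\<bar> \<le> real (Suc j) \<Longrightarrow> \<bar>t\<bar> \<le> real (Suc j) \<Longrightarrow>
      \<exists>n k. int M \<le> \<bar>k\<bar> \<and> \<bar>k\<bar> < int (N j M) \<and> x * a n + t \<in> hole m k (F j M k)"
    by metis
  define M where "M = rec_nat 0 N"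
  have M_Suc: "M (Suc j) = N j (M j)" for j by (simp add: M_def)
  have "strict_mono M" using N by (simp add: strict_mono_Suc_iff M_Suc)
  then have mono: "M i \<le> M j" if "i \<le> j" for i j using that by (simp add: strict_mono_less_eq)
  define block where "block k = (LEAST j. \<bar>k\<bar> < int (M (Suc j)))" for k
  have block: "block k = j" if "int (M j) \<le> \<bar>k\<bar>" "\<bar>k\<bar> < int (M (Suc j))" for j k
    unfolding block_def
  proof (rule Least_equality)
    fix i assume i: "\<bar>k\<bar> < int (M (Suc i))"
    show "j \<le> i"
    proof (rule ccontr)
      assume "\<not> j \<le> i"
      then have "M (Suc i) \<le> M j" by (intro mono) simp
      with i that show False by linarith
    qed
  qed (use that in simp)
  define f where "f k = F (block k) (M (block k)) k" for k
  show thesis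
  proof
    show "f k \<in> {0..<int m}" for k unfolding f_def by (rule F)
    fix x t :: real assume "x \<noteq> 0"
    obtain j :: nat where j: "max (max (1 / \<bar>x\<bar>) \<bar>x\<bar>) \<bar>t\<bar> \<le> real j" using real_arch_simple by blast
    then have "1 / \<bar>x\<bar> \<le> real (Suc j)" by simp
    then have "1 / real (Suc j) \<le> \<bar>x\<bar>" using \<open>x \<noteq> 0\<close> by (simp add: field_simps)
    then obtain n k where "int (M j) \<le> \<bar>k\<bar>" "\<bar>k\<bar> < int (N j (M j))"
      and *: "x * a n + t \<in> hole m k (F j (M j) k)"
      using hit[of j x t "M j"] j by auto
    then have "block k = j" by (intro block) (simp_all add: M_Suc)
    with * show "\<exists>n k. x * a n + t \<in> hole m k (f k)" unfolding f_def by metis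
  qed
qed

theorem theorem1p5:
  fixes a :: "nat \<Rightarrow> real"
  assumes "incseq a"
    and "upper_banach_density (range (\<lambda>n. \<lfloor>a n\<rfloor>)) > 0"
  shows "\<forall>\<epsilon>::real. 0 < \<epsilon> \<and> \<epsilon> \<le> 1 \<longrightarrow>
           (\<exists>S. large_set (1 - \<epsilon>) S \<and> (\<forall>B. affine_copy_of B (range a) \<longrightarrow> \<not> B \<subseteq> S))"
proof (intro allI impI)
  fix \<epsilon> :: real assume \<epsilon>: "0 < \<epsilon> \<and> \<epsilon> \<le> 1"
  obtain m :: nat where "max 3 (12 / \<epsilon>) \<le> real m" using real_arch_simple by blast
  then have m: "3 \<le> m" and "12 / \<epsilon> \<le> real m" by auto
  then have m\<epsilon>: "12 / real m \<le> \<epsilon>" using \<epsilon> by (simp add: field_simps)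
  have "a 0 \<le> a n" for n using \<open>incseq a\<close> by (simp add: incseq_def)
  then obtain f :: "int \<Rightarrow> int" where f: "\<And>k. f k \<in> {0..<int m}"
    and hit: "\<And>x t. x \<noteq> 0 \<Longrightarrow> \<exists>n k. x * a n + t \<in> hole m k (f k)"
    using exists_colouring_meeting_all_affine_copies[OF assms(2) _ m] by metis
  define S where "S = - (\<Union>k. hole m k (f k))"
  have "large_set (1 - 12 / real m) S"
    unfolding S_def using f by (intro complement_of_short_intervals_large m) auto
  then have "large_set (1 - \<epsilon>) S"
    using m\<epsilon> unfolding large_set_def by fastforce
  moreover have "\<not> B \<subseteq> S" if B: "affine_copy_of B (range a)" for B
  proof -
    obtain x t where x: "x \<noteq> 0" "B = (\<lambda>u. x * u + t) ` range a"
      using B unfolding affine_copy_of_def by blast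
    show ?thesis using hit[OF x(1), of t] unfolding x(2) S_def by blast
  qed
  ultimately show "\<exists>S. large_set (1 - \<epsilon>) S \<and> (\<forall>B. affine_copy_of B (range a) \<longrightarrow> \<not> B \<subseteq> S)"
    by blast
qed
end
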